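(* Let the iterative algorithm given by $A:\mathbb{R}^{Nd}\times\mathcal{X}\to\mathcal{X}$ and $C=(C_1,\ldots,C_N):\mathcal{X}\to\mathbb{R}^{Nd}$ be $\sigma$-linear convergent in the norm $\|\cdot\|$ with $\sigma\in(0,1)$, point $\mathbf{x}^\star$ and constants $L_A>0$, $L_C\ge 0$ (as defined in the context). Let $b\ge 1$ be an integer and consider the $b$-bit quantized algorithm described in the context, started at $\mathbf{x}^0\in\mathcal{X}$. Let $D>0$ be such that either (i) $\|\mathbf{x}^1-\mathbf{x}^0\|\le(1-\sigma)D$, or (ii) $\|\mathbf{x}^0-\mathbf{x}^\star\|\le D$. Set $$r^k=\frac{K}{L_A}\,\alpha(b)^{k+1}D,\qquad \alpha(b)=\frac{K}{2^b-1}+\sigma,\qquad K=\max\left\{1,\frac{2L_AL_C}{\sigma}\right\},$$ and assume $\alpha(b)<1$. Consider the faulty-transmission model with the "communicate until success" scheme described in the context, with failure probability $p\in(0,1)$, finite nonempty set of links $\mathcal{L}$, overhead $\theta\ge0$, $n=bd+\theta$, and delay function $\Delta(n,p)=n/R(n,p)$. For $\epsilon>0$ let $$k_\epsilon(b)=\max\left\{1,\left\lceil\frac{1}{1-\alpha(b)}\log\left(\frac{D}{\epsilon}\right)\right\rceil\right\},\qquad T_\epsilon(b,\theta,p)=\Delta(n,p)\sum_{k=1}^{k_\epsilon(b)}m_k .$$ Then for any $\epsilon>0$, $$\|\mathbf{x}(t)-\mathbf{x}^\star\|\le\epsilon\quad\text{for all }t\ge T_\epsilon(b,\theta,p),$$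 and $$k_\epsilon(b)\,\Delta(bd+\theta,p)\,\frac{\log(|\mathcal{L}|)}{\log(1/p)}\;\le\;E[T_\epsilon(b,\theta,p)]\;\le\;k_\epsilon(b)\,\Delta(bd+\theta,p)\left(\frac{1+\log(|\mathcal{L}|)}{\log(1/p)}+1\right).$$
   Context: $\mathbb{N}=\{0,1,2,\ldots\}$; $\log$ is the natural logarithm; $N,d\ge1$ are integers; $\|\cdot\|_\infty$ is the max-norm. $\mathcal{X}$ is a subset of a finite-dimensional Euclidean space and $\|\cdot\|$ is a norm (on the linear span of $\mathcal{X}$). Unquantized algorithm: $\mathbf{x}^{k+1}=A(\mathbf{c}^k,\mathbf{x}^k)$, $\mathbf{c}_i^{k+1}=C_i(\mathbf{x}^{k+1})$ for $i=1,\ldots,N$, where $\mathbf{c}^k=(\mathbf{c}^k_1,\ldots,\mathbf{c}^k_N)$, $A:\mathbb{R}^{Nd}\times\mathcal{X}\to\mathcal{X}$, $C_i:\mathcal{X}\to\mathbb{R}^d$, and $C(\mathbf{x})=(C_1(\mathbf{x}),\ldots,C_N(\mathbf{x}))$. $\sigma$-linear convergent in the norm $\|\cdot\|$: (a) there is $\mathbf{x}^\star\in\mathcal{X}$ with $\|A(C(\mathbf{x}),\mathbf{x})-\mathbf{x}^\star\|\le\sigma\|\mathbf{x}-\mathbf{x}^\star\|$ for all $\mathbf{x}\in\mathcal{X}$; (b) there are constants $L_A,L_C$ such that $\|A(\mathbf{c}_1,\mathbf{x})-A(\mathbf{c}_2,\mathbf{x})\|\le L_A\|\mathbf{c}_1-\mathbf{c}_2\|_\infty$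 and $\|C(\mathbf{x}_1)-C(\mathbf{x}_2)\|_\infty\le L_C\|\mathbf{x}_1-\mathbf{x}_2\|$ for all $\mathbf{x},\mathbf{x}_1,\mathbf{x}_2\in\mathcal{X}$, $\mathbf{c}_1,\mathbf{c}_2\in\mathbb{R}^{Nd}$. Quantization function $\mathrm{quant}:\mathbb{R}^d\times\mathbb{R}^d\times\mathbb{R}_+\times\mathbb{N}\to\mathbb{R}^d$, defined componentwise with $\delta=r/(2^b-1)$ (first applicable case): $$[\mathrm{quant}(\mathbf{c},\mathbf{q},r,b)]_j=\begin{cases}\mathbf{q}_j-r&\text{if }\mathbf{c}_j\le\mathbf{q}_j-r+\delta,\\ \mathbf{q}_j+r&\text{if }\mathbf{c}_j\ge\mathbf{q}_j+r-\delta,\\ \mathbf{q}_j-r+2\delta\left\lfloor\frac{\mathbf{c}_j-\mathbf{q}_j+r+\delta}{2\delta}\right\rfloor&\text{otherwise.}\end{cases}$$ $b$-bit quantized algorithm: given $\mathbf{x}^0\in\mathcal{X}$, set $\mathbf{q}_i^0=\mathbf{c}_i^0=C_i(\mathbf{x}^0)$, and for $k\in\mathbb{N}$, with $\mathbf{q}^k=(\mathbf{q}^k_1,\ldots,\mathbf{q}^k_N)$, $$\mathbf{x}^{k+1}=A(\mathbf{q}^k,\mathbf{x}^k),\quad \mathbf{c}_i^{k+1}=C_i(\mathbf{x}^{k+1}),\quad \mathbf{q}_i^{k+1}=\mathrm{quant}(\mathbf{c}_i^{k+1},\mathbf{q}_i^k,r^k,b),\quad i=1,\ldots,N.$$ Faulty-transmission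 model: $\mathcal{L}$ is the set of communication links (sender-receiver pairs) used by the algorithm. Per iteration each node communicates a package of $n=bd+\theta$ bits; $R(n,p)>0$ is the transmission rate (bits/second), and one round of communication takes $\Delta(n,p)=n/R(n,p)$ seconds. Each transmission over each link fails with probability $p$, independently across time and links. Communicate until success: at each iteration messages are retransmitted until every message has been received, so the iterates $\mathbf{x}^k$ are those of the quantized algorithm. The number $m_k$ of communication rounds at iteration $k$ is a copy of $M=\max_{l\in\mathcal{L}}S_l$, where the $S_l$ are independent with $P[S_l=m]=p^{m-1}(1-p)$, $m=1,2,\ldots$ (number of transmissions on link $l$ until success). Performing $k$ iterations takes $\Delta(n,p)\sum_{i=1}^km_i$ seconds, and $\mathbf{x}(t)=\mathbf{x}^k$ for $t\in\big[\Delta(n,p)\sum_{i=1}^km_i,\ \Delta(n,p)\sum_{i=1}^{k+1}m_i\big)$. *)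

theory Defs
  imports "HOL-Probability.Probability"
begin

section \<open>The iterative algorithm and linear convergence\<close>

definition norm_on :: "'a::real_vector set \<Rightarrow> ('a \<Rightarrow> real) \<Rightarrow> bool" where
  "norm_on V nrm \<longleftrightarrow>
     (\<forall>x\<in>V. 0 \<le> nrm x) \<and>
     (\<forall>x\<in>V. nrm x = 0 \<longleftrightarrow> x = 0) \<and>
     (\<forall>a. \<forall>x\<in>V. nrm (a *\<^sub>R x) = \<bar>a\<bar> * nrm x) \<and>
     (\<forall>x\<in>V. \<forall>y\<in>V. nrm (x + y) \<le> nrm x + nrm y)"

text \<open>
  The space of all messages is \<^typ>\<open>(real^'d)^'n\<close>, with \<open>CARD('n)\<close> blocks of dimension
  \<open>CARD('d)\<close>.  On it \<^const>\<open>infnorm\<close> is the maximum of the absolute values of all coordinates.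
\<close>

definition stack :: "('n::finite \<Rightarrow> 'a \<Rightarrow> real^'d) \<Rightarrow> 'a \<Rightarrow> (real^'d)^'n" where
  "stack C x = (\<chi> i. C i x)"

definition linear_convergent ::
  "'a::euclidean_space set \<Rightarrow> ('a \<Rightarrow> real) \<Rightarrow> ((real^'d::finite)^'n::finite \<Rightarrow> 'a \<Rightarrow> 'a) \<Rightarrow>
   ('n \<Rightarrow> 'a \<Rightarrow> real^'d) \<Rightarrow> real \<Rightarrow> 'a \<Rightarrow> real \<Rightarrow> real \<Rightarrow> bool" where
  "linear_convergent X nrm A C \<sigma> xs L\<^sub>A L\<^sub>C \<longleftrightarrow>
     xs \<in> X \<and>
     (\<forall>x\<in>X. nrm (A (stack C x) x - xs) \<le> \<sigma> * nrm (x - xs)) \<and>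
     (\<forall>x\<in>X. \<forall>c1 c2. nrm (A c1 x - A c2 x) \<le> L\<^sub>A * infnorm (c1 - c2)) \<and>
     (\<forall>x1\<in>X. \<forall>x2\<in>X. infnorm (stack C x1 - stack C x2) \<le> L\<^sub>C * nrm (x1 - x2))"

section \<open>The quantized algorithm\<close>

definition quant :: "real^'d \<Rightarrow> real^'d \<Rightarrow> real \<Rightarrow> nat \<Rightarrow> real^'d" where
  "quant c q r b = (\<chi> j. let \<delta> = r / (2 ^ b - 1) in
     if c $ j \<le> q $ j - r + \<delta> then q $ j - r
     else if c $ j \<ge> q $ j + r - \<delta> then q $ j + r
     else q $ j - r + 2 * \<delta> * of_int \<lfloor>(c $ j - q $ j + r + \<delta>) / (2 * \<delta>)\<rfloor>)"

text \<open>The state at step \<open>k\<close> is the pair of the iterate and the quantized messages.\<close>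

primrec quantized_state ::
  "((real^'d::finite)^'n::finite \<Rightarrow> 'a \<Rightarrow> 'a) \<Rightarrow> ('n \<Rightarrow> 'a \<Rightarrow> real^'d) \<Rightarrow> (nat \<Rightarrow> real) \<Rightarrow> nat \<Rightarrow> 'a
   \<Rightarrow> nat \<Rightarrow> 'a \<times> ((real^'d)^'n)" where
  "quantized_state A C r b x0 0 = (x0, stack C x0)"
| "quantized_state A C r b x0 (Suc k) =
     (let (x, q) = quantized_state A C r b x0 k; x' = A q x
      in (x', \<chi> i. quant (C i x') (q $ i) (r k) b))"

definition quantized_iterate ::
  "((real^'d::finite)^'n::finite \<Rightarrow> 'a \<Rightarrow> 'a) \<Rightarrow> ('n \<Rightarrow> 'a \<Rightarrow> real^'d) \<Rightarrow> (nat \<Rightarrow> real) \<Rightarrow> nat \<Rightarrow> 'a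
   \<Rightarrow> nat \<Rightarrow> 'a" where
  "quantized_iterate A C r b x0 k = fst (quantized_state A C r b x0 k)"

definition gain :: "real \<Rightarrow> real \<Rightarrow> real \<Rightarrow> real" where
  "gain \<sigma> L\<^sub>A L\<^sub>C = max 1 (2 * L\<^sub>A * L\<^sub>C / \<sigma>)"

definition rate :: "real \<Rightarrow> real \<Rightarrow> real \<Rightarrow> nat \<Rightarrow> real" where
  "rate \<sigma> L\<^sub>A L\<^sub>C b = gain \<sigma> L\<^sub>A L\<^sub>C / (2 ^ b - 1) + \<sigma>"

definition radius :: "real \<Rightarrow> real \<Rightarrow> real \<Rightarrow> nat \<Rightarrow> real \<Rightarrow> nat \<Rightarrow> real" where
  "radius \<sigma> L\<^sub>A L\<^sub>C b D k = gain \<sigma> L\<^sub>A L\<^sub>C / L\<^sub>A * rate \<sigma> L\<^sub>A L\<^sub>C b ^ (k + 1) * D"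

definition num_iterations :: "real \<Rightarrow> real \<Rightarrow> real \<Rightarrow> nat" where
  "num_iterations \<alpha> D \<epsilon> = nat (max 1 \<lceil>1 / (1 - \<alpha>) * ln (D / \<epsilon>)\<rceil>)"

section \<open>Faulty transmissions, communicating until success\<close>

text \<open>
  \<open>S k l\<close> is the number of transmissions that the message of iteration \<open>k \<ge> 1\<close> needs on
  link \<open>l\<close>.  Failures that are independent across time and links make these numbers
  independent over all iterations and links.
\<close>

locale faulty_transmissions = prob_space M for M :: "'w measure" +
  fixes L :: "('v \<times> 'v) set" and p :: real and S :: "nat \<Rightarrow> 'v \<times> 'v \<Rightarrow> 'w \<Rightarrow> nat"
  assumes indep_S: "indep_vars (\<lambda>_. count_space UNIV) (\<lambda>(k, l). S k l) ({1..} \<times> L)"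
    and S_pos: "\<lbrakk>1 \<le> k; l \<in> L; \<omega> \<in> space M\<rbrakk> \<Longrightarrow> 1 \<le> S k l \<omega>"
    and prob_S: "\<lbrakk>1 \<le> k; l \<in> L; 1 \<le> m\<rbrakk> \<Longrightarrow>
      prob {\<omega> \<in> space M. S k l \<omega> = m} = p ^ (m - 1) * (1 - p)"

definition rounds ::
  "('v \<times> 'v) set \<Rightarrow> (nat \<Rightarrow> 'v \<times> 'v \<Rightarrow> 'w \<Rightarrow> nat) \<Rightarrow> nat \<Rightarrow> 'w \<Rightarrow> nat" where
  "rounds L S k \<omega> = Max ((\<lambda>l. S k l \<omega>) ` L)"

definition delay :: "(real \<Rightarrow> real \<Rightarrow> real) \<Rightarrow> real \<Rightarrow> real \<Rightarrow> real" where
  "delay R n p = n / R n p"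

text \<open>\<open>elapsed \<tau> m k\<close>: duration of \<open>k\<close> iterations with round length \<open>\<tau>\<close> and \<open>m i\<close> rounds in iteration \<open>i\<close>.\<close>

definition elapsed :: "real \<Rightarrow> (nat \<Rightarrow> nat) \<Rightarrow> nat \<Rightarrow> real" where
  "elapsed \<tau> m k = \<tau> * (\<Sum>i=1..k. real (m i))"

text \<open>The index is unique and exists for all \<open>t \<ge> 0\<close> if \<open>\<tau> > 0\<close> and all \<open>m i \<ge> 1\<close> (\<open>i \<ge> 1\<close>).\<close>

definition in_time :: "real \<Rightarrow> (nat \<Rightarrow> nat) \<Rightarrow> (nat \<Rightarrow> 'a) \<Rightarrow> real \<Rightarrow> 'a" where
  "in_time \<tau> m x t = x (THE k. elapsed \<tau> m k \<le> t \<and> t < elapsed \<tau> m (k + 1))"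

end

theory Submission
  imports Defs
begin

text \<open>
  Two independent facts combine.

  \<^emph>\<open>Deterministic part.\<close>  One induction carries two bounds at once: the iterate is within
  \<open>\<alpha>^k * D\<close> of the fixed point, and the quantized messages are so close to the true ones that using
  them costs at most \<open>K / (2^b - 1) * \<alpha>^k * D\<close> in the next iterate
  (\<open>quantized_iterates_converge\<close>).  The first bound makes consecutive iterates, hence consecutive
  messages, close to each other; together with the second it puts the new message inside the
  quantizer's range, the cube of half-width \<open>r^k\<close> about the old quantized message.  There the
  quantizer is accurate up to \<open>r^k / (2^b - 1)\<close> (\<open>quant_error\<close>), which re-establishes the second
  bound.  The number \<open>K\<close> is chosen to make this range argument close.  Since
  \<open>\<alpha>^k \<le> exp (- (1 - \<alpha>) * k)\<close>, the stated number of iterations reaches the accuracy \<open>\<epsilon>\<close>, and as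
  every iteration takes positive time, all times after \<open>T\<close> show an iterate at least that late.

  \<^emph>\<open>Stochastic part.\<close>  By independence the number of rounds of one iteration exceeds \<open>j\<close> with
  probability \<open>1 - (1 - p^j)^n\<close>, where \<open>n\<close> is the number of links, so its expectation is the sum of
  these tails over \<open>j\<close>.  The tail is decreasing in \<open>j\<close>, and as a function of real \<open>j\<close> its integral
  over \<open>[0, \<infinity>)\<close> is \<open>H\<^sub>n / ln (1/p)\<close> with the harmonic number \<open>H\<^sub>n\<close> (the expected maximum of \<open>n\<close>
  exponential variables).  Comparing sum and integral gives the expectation up to an additive \<open>1\<close>
  (\<open>max_geometric_tail_sum\<close>), and \<open>ln n \<le> H\<^sub>n \<le> 1 + ln n\<close>.
\<close>

section \<open>Accuracy of the quantizer\<close>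

lemma infnorm_le_iff_blocks:
  fixes x :: "(real^'d::finite)^'n::finite"
  shows "infnorm x \<le> e \<longleftrightarrow> (\<forall>i j. \<bar>x $ i $ j\<bar> \<le> e)"
proof -
  have "infnorm x \<le> e \<longleftrightarrow> (\<forall>b\<in>Basis. \<bar>x \<bullet> b\<bar> \<le> e)"
    unfolding infnorm_Max by (subst Max_le_iff) auto
  also have "\<dots> \<longleftrightarrow> (\<forall>i j. \<bar>x $ i $ j\<bar> \<le> e)"
    by (simp add: Basis_vec_def inner_axis)
  finally show ?thesis .
qed

text \<open>
  Near the two ends of the range the quantized value is the end itself, at distance at most
  \<open>\<delta> = r / (2^b - 1)\<close>; in between, rounding to a grid of spacing \<open>2 * \<delta>\<close> moves a number by at
  most \<open>\<delta>\<close>.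
\<close>

lemma quant_error:
  assumes b: "1 \<le> b" and r: "0 < r" and in_range: "\<bar>c $ j - q $ j\<bar> \<le> r"
  shows "\<bar>quant c q r b $ j - c $ j\<bar> \<le> r / (2 ^ b - 1)"
proof -
  define \<delta> where "\<delta> = r / (2 ^ b - 1 :: real)"
  have "(1::real) < 2 ^ b"
    using b by (intro one_less_power) auto
  then have \<delta>: "0 < \<delta>"
    using r by (simp add: \<delta>_def)
  define y where "y = (c $ j - q $ j + r + \<delta>) / (2 * \<delta>)"
  have y: "2 * \<delta> * y = c $ j - q $ j + r + \<delta>"
    using \<delta> by (simp add: y_def)
  have "2 * \<delta> * of_int \<lfloor>y\<rfloor> \<le> 2 * \<delta> * y" "2 * \<delta> * y \<le> 2 * \<delta> * (of_int \<lfloor>y\<rfloor> + 1)"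
    using \<delta> by (intro mult_left_mono; linarith)+
  then have "\<bar>q $ j - r + 2 * \<delta> * of_int \<lfloor>y\<rfloor> - c $ j\<bar> \<le> \<delta>"
    unfolding y by (simp add: algebra_simps)
  then show ?thesis
    using in_range unfolding quant_def Let_def \<delta>_def[symmetric] y_def
    by (auto simp: abs_le_iff)
qed

section \<open>Convergence of the quantized iterates\<close>

lemma norm_on_diff_triangle:
  assumes "norm_on (span X) nrm" "x \<in> X" "y \<in> X" "z \<in> X"
  shows "nrm (x - z) \<le> nrm (x - y) + nrm (y - z)"
proof -
  have "x - y \<in> span X" "y - z \<in> span X"
    using assms by (auto intro: span_diff span_base)
  moreover have "\<forall>v\<in>span X. \<forall>w\<in>span X. nrm (v + w) \<le> nrm v + nrm w"
    using assms(1) unfolding norm_on_def by (elim conjE)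
  ultimately have "nrm ((x - y) + (y - z)) \<le> nrm (x - y) + nrm (y - z)"
    by blast
  then show ?thesis by simp
qed

lemma norm_on_diff_commute:
  assumes "norm_on (span X) nrm" "x \<in> X" "y \<in> X"
  shows "nrm (x - y) = nrm (y - x)"
proof -
  have "y - x \<in> span X"
    using assms by (auto intro: span_diff span_base)
  moreover have "\<forall>c. \<forall>v\<in>span X. nrm (c *\<^sub>R v) = \<bar>c\<bar> * nrm v"
    using assms(1) unfolding norm_on_def by (elim conjE)
  ultimately have "nrm ((-1) *\<^sub>R (y - x)) = \<bar>-1\<bar> * nrm (y - x)"
    by blast
  then show ?thesis by simp
qed

text \<open>
  The first quantized messages are exact, so the first step is an unquantized one and contracts
  towards the fixed point.  A short first step therefore means that the start is close to it.
\<close>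

lemma short_contracting_step_imp_close:
  assumes nrm: "norm_on (span X) nrm" and "x0 \<in> X" "x1 \<in> X" "xs \<in> X" and "\<sigma> < 1"
    and contract: "nrm (x1 - xs) \<le> \<sigma> * nrm (x0 - xs)"
    and short: "nrm (x1 - x0) \<le> (1 - \<sigma>) * D"
  shows "nrm (x0 - xs) \<le> D"
proof -
  have "nrm (x0 - xs) \<le> nrm (x1 - x0) + nrm (x1 - xs)"
    using norm_on_diff_triangle[OF nrm \<open>x0 \<in> X\<close> \<open>x1 \<in> X\<close> \<open>xs \<in> X\<close>]
    unfolding norm_on_diff_commute[OF nrm \<open>x0 \<in> X\<close> \<open>x1 \<in> X\<close>] .
  then have "(1 - \<sigma>) * nrm (x0 - xs) \<le> (1 - \<sigma>) * D"
    using contract short by (simp add: algebra_simps)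
  then show ?thesis
    using \<open>\<sigma> < 1\<close> by simp
qed

text \<open>
  The factor \<open>1 + \<alpha> \<le> 2\<close> comes from bounding the distance of consecutive iterates by the sum of
  their distances to the fixed point; it is the reason for the \<open>2\<close> in the definition of \<open>K\<close>.
  The messages then move by at most \<open>K * \<sigma> / L\<^sub>A\<close> in units of the current error, and
  \<open>K \<ge> 1\<close> absorbs the old quantization error into the range.
\<close>

lemma quantizer_range_closes:
  fixes a :: real
  assumes "0 < \<sigma>" "0 < L\<^sub>A" "0 \<le> L\<^sub>C" and K: "K = gain \<sigma> L\<^sub>A L\<^sub>C"
    and \<alpha>: "\<alpha> = K / B + \<sigma>" and "\<alpha> \<le> 1" "0 < B" "0 \<le> a"
  shows "L\<^sub>C * (\<alpha> * a + a) + K / (L\<^sub>A * B) * a \<le> K / L\<^sub>A * (\<alpha> * a)"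
proof -
  have K1: "1 \<le> K" and "2 * L\<^sub>A * L\<^sub>C / \<sigma> \<le> K"
    by (auto simp: K gain_def)
  then have "2 * (L\<^sub>A * L\<^sub>C) \<le> K * \<sigma>"
    using \<open>0 < \<sigma>\<close> by (simp add: pos_divide_le_eq)
  moreover have "L\<^sub>A * L\<^sub>C * (\<alpha> + 1) \<le> L\<^sub>A * L\<^sub>C * 2"
    using assms by (intro mult_left_mono) auto
  ultimately have "L\<^sub>A * L\<^sub>C * (\<alpha> + 1) \<le> K * \<sigma>"
    by linarith
  moreover have "K / B \<le> K * (K / B)"
    using mult_right_mono[OF K1, of "K / B"] K1 \<open>0 < B\<close> by simp
  ultimately have "L\<^sub>A * L\<^sub>C * (\<alpha> + 1) + K / B \<le> K * \<alpha>"
    unfolding \<alpha> by (simp add: algebra_simps)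
  then have "(L\<^sub>A * L\<^sub>C * (\<alpha> + 1) + K / B) * (a / L\<^sub>A) \<le> K * \<alpha> * (a / L\<^sub>A)"
    using assms by (intro mult_right_mono) auto
  then show ?thesis
    using \<open>0 < L\<^sub>A\<close> \<open>0 < B\<close> by (simp add: field_simps)
qed

text \<open>
  Without quantization errors an iteration contracts by \<open>\<sigma>\<close>; the term \<open>K / (2^b - 1)\<close> of the rate
  pays for them.  The claim is not inductive on its own: whether the next message falls into the
  range of the quantizer depends on how accurate the current quantized message is, so the induction
  also carries a bound on that error, of the same geometric decay.
\<close>

theorem quantized_iterates_converge:
  fixes X :: "'a::euclidean_space set" and C :: "'n::finite \<Rightarrow> 'a \<Rightarrow> real^'d::finite"
  assumes nrm: "norm_on (span X) nrm"
    and AX: "\<And>c x. x \<in> X \<Longrightarrow> A c x \<in> X"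
    and pos: "0 < \<sigma>" "0 < L\<^sub>A" "0 \<le> L\<^sub>C" "0 < D"
    and conv: "linear_convergent X nrm A C \<sigma> xs L\<^sub>A L\<^sub>C"
    and b: "1 \<le> b" and x0: "x0 \<in> X" and start: "nrm (x0 - xs) \<le> D"
    and \<alpha>: "\<alpha> = rate \<sigma> L\<^sub>A L\<^sub>C b" and "\<alpha> \<le> 1"
  shows "nrm (quantized_iterate A C (radius \<sigma> L\<^sub>A L\<^sub>C b D) b x0 k - xs) \<le> \<alpha> ^ k * D"
proof -
  define K B where "K = gain \<sigma> L\<^sub>A L\<^sub>C" and "B = (2 ^ b - 1 :: real)"
  define x q where "x k = fst (quantized_state A C (radius \<sigma> L\<^sub>A L\<^sub>C b D) b x0 k)"
    and "q k = snd (quantized_state A C (radius \<sigma> L\<^sub>A L\<^sub>C b D) b x0 k)" for k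
  have x_Suc: "x (Suc k) = A (q k) (x k)"
    and q_Suc: "q (Suc k) $ i = quant (C i (x (Suc k))) (q k $ i) (radius \<sigma> L\<^sub>A L\<^sub>C b D k) b" for k i
    by (simp_all add: x_def q_def case_prod_unfold Let_def)
  have "1 \<le> K"
    by (simp add: K_def gain_def)
  have "(1::real) < 2 ^ b"
    using b by (intro one_less_power) auto
  then have "0 < B"
    by (simp add: B_def)
  have \<alpha>_eq: "\<alpha> = K / B + \<sigma>"
    by (simp add: \<alpha> rate_def K_def B_def)
  have "0 < \<alpha>"
    using \<open>1 \<le> K\<close> \<open>0 < B\<close> pos by (auto simp: \<alpha>_eq intro!: add_pos_pos)
  have radius: "radius \<sigma> L\<^sub>A L\<^sub>C b D k = K / L\<^sub>A * (\<alpha> * (\<alpha> ^ k * D))" for k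
    by (simp add: radius_def K_def \<alpha>)
  have xs: "xs \<in> X"
    and contract: "\<And>y. y \<in> X \<Longrightarrow> nrm (A (stack C y) y - xs) \<le> \<sigma> * nrm (y - xs)"
    and lip_A: "\<And>y c1 c2. y \<in> X \<Longrightarrow> nrm (A c1 y - A c2 y) \<le> L\<^sub>A * infnorm (c1 - c2)"
    and lip_C: "\<And>y z. \<lbrakk>y \<in> X; z \<in> X\<rbrakk> \<Longrightarrow> infnorm (stack C y - stack C z) \<le> L\<^sub>C * nrm (y - z)"
    using conv unfolding linear_convergent_def by blast+
  have "x k \<in> X \<and> nrm (x k - xs) \<le> \<alpha> ^ k * D \<and>
    infnorm (q k - stack C (x k)) \<le> K / (L\<^sub>A * B) * (\<alpha> ^ k * D)" for k
  proof (induction k)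
    case 0
    then show ?case
      using x0 start pos \<open>1 \<le> K\<close> \<open>0 < B\<close> by (simp add: x_def q_def infnorm_0)
  next
    case (Suc k)
    define a where "a = \<alpha> ^ k * D"
    have "0 < a"
      using \<open>0 < \<alpha>\<close> pos by (simp add: a_def)
    have xk: "x k \<in> X" and err: "nrm (x k - xs) \<le> a"
      and qerr: "infnorm (q k - stack C (x k)) \<le> K / (L\<^sub>A * B) * a"
      using Suc.IH by (auto simp: a_def)
    have xk': "x (Suc k) \<in> X"
      using AX xk by (simp add: x_Suc)
    have "nrm (x (Suc k) - xs)
        \<le> nrm (A (q k) (x k) - A (stack C (x k)) (x k)) + nrm (A (stack C (x k)) (x k) - xs)"
      unfolding x_Suc by (intro norm_on_diff_triangle[OF nrm] AX xk xs)
    also have "\<dots> \<le> L\<^sub>A * infnorm (q k - stack C (x k)) + \<sigma> * nrm (x k - xs)"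
      by (intro add_mono lip_A contract xk)
    also have "\<dots> \<le> L\<^sub>A * (K / (L\<^sub>A * B) * a) + \<sigma> * a"
      using pos by (intro add_mono mult_left_mono qerr err) auto
    also have "\<dots> = \<alpha> * a"
      using pos by (simp add: \<alpha>_eq algebra_simps)
    finally have err': "nrm (x (Suc k) - xs) \<le> \<alpha> * a" .
    have "nrm (x (Suc k) - x k) \<le> \<alpha> * a + a"
      using norm_on_diff_triangle[OF nrm xk' xs xk] norm_on_diff_commute[OF nrm xs xk] err err'
      by simp
    then have "infnorm (stack C (x (Suc k)) - stack C (x k)) \<le> L\<^sub>C * (\<alpha> * a + a)"
      using lip_C[OF xk' xk] pos(3) by (meson mult_left_mono order_trans)
    then have "infnorm (stack C (x (Suc k)) - q k) \<le> L\<^sub>C * (\<alpha> * a + a) + K / (L\<^sub>A * B) * a"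
      using infnorm_triangle[of "stack C (x (Suc k)) - stack C (x k)" "stack C (x k) - q k"] qerr
        infnorm_sub[of "stack C (x k)" "q k"]
      by simp
    also have "\<dots> \<le> K / L\<^sub>A * (\<alpha> * a)"
      by (rule quantizer_range_closes[OF pos(1-3) K_def \<alpha>_eq \<open>\<alpha> \<le> 1\<close> \<open>0 < B\<close> less_imp_le[OF \<open>0 < a\<close>]])
    also have r: "K / L\<^sub>A * (\<alpha> * a) = radius \<sigma> L\<^sub>A L\<^sub>C b D k"
      by (simp add: radius a_def)
    finally have in_range: "\<bar>C i (x (Suc k)) $ j - q k $ i $ j\<bar> \<le> radius \<sigma> L\<^sub>A L\<^sub>C b D k" for i j
      by (simp add: infnorm_le_iff_blocks stack_def)
    have "0 < radius \<sigma> L\<^sub>A L\<^sub>C b D k"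
      unfolding r[symmetric] using pos \<open>0 < a\<close> \<open>0 < \<alpha>\<close> \<open>1 \<le> K\<close> by simp
    from quant_error[OF b this in_range]
    have "infnorm (q (Suc k) - stack C (x (Suc k))) \<le> radius \<sigma> L\<^sub>A L\<^sub>C b D k / B"
      by (simp add: infnorm_le_iff_blocks stack_def q_Suc B_def)
    also have "\<dots> = K / (L\<^sub>A * B) * (\<alpha> * a)"
      by (simp add: r[symmetric])
    finally show ?case
      using xk' err' by (simp add: a_def mult.assoc)
  qed
  then show ?thesis
    by (simp add: quantized_iterate_def x_def)
qed

text \<open>
  The tangent bound \<open>ln \<alpha> \<le> \<alpha> - 1\<close> is what replaces the exact count \<open>ln (D / \<epsilon>) / ln (1 / \<alpha>)\<close> by
  one with \<open>1 - \<alpha>\<close> in the denominator.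
\<close>

lemma power_num_iterations_le:
  assumes "0 < \<alpha>" "\<alpha> < 1" "0 < D" "0 < \<epsilon>" and k: "num_iterations \<alpha> D \<epsilon> \<le> k"
  shows "\<alpha> ^ k * D \<le> \<epsilon>"
proof -
  have "1 / (1 - \<alpha>) * ln (D / \<epsilon>) \<le> real k"
    using k unfolding num_iterations_def by linarith
  then have "ln (D / \<epsilon>) \<le> real k * (1 - \<alpha>)"
    using \<open>\<alpha> < 1\<close> by (simp add: pos_divide_le_eq)
  moreover have "ln \<alpha> \<le> \<alpha> - 1"
    using \<open>0 < \<alpha>\<close> by (rule ln_le_minus_one)
  then have "real k * ln \<alpha> \<le> real k * (\<alpha> - 1)"
    by (intro mult_left_mono) auto
  ultimately have "ln (\<alpha> ^ k * D) \<le> ln \<epsilon>"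
    using assms by (simp add: ln_mult ln_div ln_realpow algebra_simps)
  then show ?thesis
    using assms by simp
qed

section \<open>From iterations to time\<close>

text \<open>
  Elapsed times increase strictly and without bound, so every time \<open>t\<close> lies in exactly one
  iteration, and that iteration has index at least \<open>k\<close> if \<open>k\<close> iterations are finished by time \<open>t\<close>.
\<close>

lemma in_time_eq_late_iterate:
  assumes "0 < \<tau>" and m: "\<And>i. 1 \<le> i \<Longrightarrow> 1 \<le> m i" and t: "elapsed \<tau> m k \<le> t"
  shows "\<exists>k'\<ge>k. in_time \<tau> m x t = x k'"
proof -
  have Suc: "elapsed \<tau> m (Suc i) = elapsed \<tau> m i + \<tau> * real (m (Suc i))" for i
    by (simp add: elapsed_def algebra_simps)
  have step: "elapsed \<tau> m i + \<tau> \<le> elapsed \<tau> m (Suc i)" for i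
    using m[of "Suc i"] \<open>0 < \<tau>\<close> by (simp add: Suc)
  have smono: "strict_mono (elapsed \<tau> m)"
    unfolding strict_mono_Suc_iff using step \<open>0 < \<tau>\<close> by (metis less_add_same_cancel1 less_le_trans)
  have lower: "real i * \<tau> \<le> elapsed \<tau> m i" for i
  proof (induction i)
    case (Suc i)
    then show ?case
      using step[of i] by (simp add: algebra_simps)
  qed (simp add: elapsed_def)
  have fin: "i \<le> nat \<lceil>t / \<tau>\<rceil>" if "elapsed \<tau> m i \<le> t" for i
  proof -
    have "real i \<le> t / \<tau>"
      using that lower[of i] \<open>0 < \<tau>\<close> by (simp add: field_simps)
    then show ?thesis by linarith
  qed
  define k' where "k' = (GREATEST i. elapsed \<tau> m i \<le> t)"
  have k': "elapsed \<tau> m k' \<le> t"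
    unfolding k'_def using t fin by (rule GreatestI_nat)
  have greatest: "i \<le> k'" if "elapsed \<tau> m i \<le> t" for i
    unfolding k'_def using that fin by (rule Greatest_le_nat)
  have "(THE i. elapsed \<tau> m i \<le> t \<and> t < elapsed \<tau> m (i + 1)) = k'"
  proof (rule the_equality)
    show "elapsed \<tau> m k' \<le> t \<and> t < elapsed \<tau> m (k' + 1)"
      using k' greatest[of "k' + 1"] by force
  next
    fix i assume i: "elapsed \<tau> m i \<le> t \<and> t < elapsed \<tau> m (i + 1)"
    then have "elapsed \<tau> m k' < elapsed \<tau> m (i + 1)"
      using k' by linarith
    then have "k' < i + 1"
      using smono by (simp add: strict_mono_less)
    then show "i = k'"
      using greatest[of i] i by simp
  qed
  then show ?thesis
    using greatest[OF t] by (auto simp: in_time_def)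
qed

section \<open>The expected maximum of geometric variables\<close>

text \<open>
  The function \<open>F x = (\<Sum>i<n. (1 - p^x)^(i+1) / (i+1)) / ln (1/p)\<close> has derivative
  \<open>f x = 1 - (1 - p^x)^n\<close>, vanishes at \<open>0\<close>, and tends to \<open>harm n / ln (1/p)\<close>.  As \<open>f\<close> decreases,
  the mean value theorem puts \<open>F (j + 1) - F j\<close> between \<open>f (j + 1)\<close> and \<open>f j\<close>; summing over \<open>j\<close>
  telescopes.
\<close>

lemma max_geometric_tail_sum:
  fixes p :: real and n :: nat
  assumes p: "0 < p" "p < 1"
  defines "f \<equiv> \<lambda>j. 1 - (1 - p ^ j) ^ n"
  shows "summable f"
    and "harm n / ln (1 / p) \<le> suminf f"
    and "suminf f \<le> harm n / ln (1 / p) + 1"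
proof -
  define l where "l = ln (1 / p)"
  have l: "0 < l" "ln p = - l"
    using p by (simp_all add: l_def ln_div)
  define F where "F x = (\<Sum>i<n. (1 - p powr x) ^ Suc i / (real (Suc i) * l))" for x
  define F' where "F' x = 1 - (1 - p powr x) ^ n" for x
  have "((\<lambda>x. 1 - p powr x) has_real_derivative l * p powr x) (at x)" for x
    using p l by (auto intro!: derivative_eq_intros)
  from DERIV_cdivide[OF DERIV_power_Suc[OF this]]
  have "((\<lambda>x. (1 - p powr x) ^ Suc i / (real (Suc i) * l)) has_real_derivative
      (1 + real i) * (l * p powr x * (1 - p powr x) ^ i) / (real (Suc i) * l)) (at x)" for x i
    by blast
  moreover have "(1 + real i) * (l * p powr x * (1 - p powr x) ^ i) / (real (Suc i) * l)
      = p powr x * (1 - p powr x) ^ i" for x i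
    using l by simp
  ultimately have "((\<lambda>x. (1 - p powr x) ^ Suc i / (real (Suc i) * l)) has_real_derivative
      p powr x * (1 - p powr x) ^ i) (at x)" for x i
    by (simp only:)
  then have "(F has_real_derivative (\<Sum>i<n. p powr x * (1 - p powr x) ^ i)) (at x)" for x
    unfolding F_def by (intro DERIV_sum)
  moreover have "(\<Sum>i<n. p powr x * (1 - p powr x) ^ i) = F' x" for x
    using one_diff_power_eq[of "1 - p powr x" n] by (simp add: F'_def sum_distrib_left)
  ultimately have deriv: "(F has_real_derivative F' x) (at x)" for x
    by simp
  have F'_anti: "F' y \<le> F' x" if "0 \<le> x" "x \<le> y" for x y
  proof -
    have "p powr y \<le> p powr x" "p powr x \<le> 1"
      using p that powr_mono'[of x y p] powr_mono'[of 0 x p] by auto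
    then show ?thesis
      unfolding F'_def by (intro diff_left_mono power_mono) auto
  qed
  have F'_f: "F' (real j) = f j" for j
    using p by (simp add: F'_def f_def powr_realpow)
  have between: "f (Suc j) \<le> F (real (Suc j)) - F (real j)"
      "F (real (Suc j)) - F (real j) \<le> f j" for j
  proof -
    obtain z where z: "real j < z" "z < real (Suc j)"
      and eq: "F (real (Suc j)) - F (real j) = (real (Suc j) - real j) * F' z"
      using MVT2[of "real j" "real (Suc j)" F F'] deriv by auto
    have "F (real (Suc j)) - F (real j) = F' z"
      using eq by simp
    then show "f (Suc j) \<le> F (real (Suc j)) - F (real j)" "F (real (Suc j)) - F (real j) \<le> f j"
      using F'_anti[of z "real (Suc j)"] F'_anti[of "real j" z] z unfolding F'_f by auto
  qed
  have "(\<lambda>j. F (real j)) \<longlonglongrightarrow> (\<Sum>i<n. (1 - 0) ^ Suc i / (real (Suc i) * l))"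
  proof -
    have "(\<lambda>j. p powr real j) \<longlonglongrightarrow> 0"
      using p LIMSEQ_realpow_zero[of p] by (simp add: powr_realpow)
    then show ?thesis
      unfolding F_def using l by (intro tendsto_intros) auto
  qed
  also have "(\<Sum>i<n. (1 - 0) ^ Suc i / (real (Suc i) * l)) = harm n / l"
    by (simp add: harm_altdef sum_divide_distrib divide_simps)
  finally have "(\<lambda>j. F (real (Suc j)) - F (real j)) sums (harm n / l - F (real 0))"
    by (rule telescope_sums)
  moreover have "F (real 0) = 0"
    using p by (simp add: F_def)
  ultimately have sums: "(\<lambda>j. F (real (Suc j)) - F (real j)) sums (harm n / l)"
    by simp
  have "f j \<ge> 0" for j
    using p unfolding f_def by (simp add: power_le_one)
  \<comment> \<open>Only the shifted tail lies below the increments of \<open>F\<close>; the term \<open>f 0 \<le> 1\<close> costs the additive \<open>1\<close>.\<close>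
  then have summ_Suc: "summable (\<lambda>j. f (Suc j))"
    using between(1) by (intro summable_comparison_test'[OF sums_summable[OF sums], of 0]) simp
  then show summ: "summable f"
    by (simp add: summable_Suc_iff)
  show "harm n / ln (1 / p) \<le> suminf f"
    using sums_le[OF between(2) sums summable_sums[OF summ]] by (simp add: l_def)
  have "suminf f - f 0 \<le> harm n / l"
    using sums_le[OF between(1) summable_sums[OF summ_Suc] sums] suminf_split_head[OF summ] by simp
  moreover have "f 0 \<le> 1"
    by (simp add: f_def)
  ultimately show "suminf f \<le> harm n / ln (1 / p) + 1"
    by (simp add: l_def)
qed

lemma (in prob_space) expectation_nat_eq_tail_sum:
  fixes N :: "'a \<Rightarrow> nat"
  assumes N: "N \<in> measurable M (count_space UNIV)"
    and summ: "summable (\<lambda>j. prob {\<omega> \<in> space M. j < N \<omega>})"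
  shows "integrable M (\<lambda>\<omega>. real (N \<omega>))"
    and "expectation (\<lambda>\<omega>. real (N \<omega>)) = (\<Sum>j. prob {\<omega> \<in> space M. j < N \<omega>})"
proof -
  have "(\<integral>\<^sup>+\<omega>. ennreal (real (N \<omega>)) \<partial>M) = (\<Sum>j. ennreal (prob {\<omega> \<in> space M. j < N \<omega>}))"
    using nn_integral_nat_function[OF N] by (simp add: emeasure_eq_measure ennreal_of_nat_eq_real_of_nat)
  also have "\<dots> = ennreal (\<Sum>j. prob {\<omega> \<in> space M. j < N \<omega>})"
    using summ by (intro suminf_ennreal2) auto
  finally have nn: "(\<integral>\<^sup>+\<omega>. ennreal (real (N \<omega>)) \<partial>M) = ennreal (\<Sum>j. prob {\<omega> \<in> space M. j < N \<omega>})" .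
  have meas: "(\<lambda>\<omega>. real (N \<omega>)) \<in> borel_measurable M"
    using N by measurable
  show "integrable M (\<lambda>\<omega>. real (N \<omega>))"
    using meas nn by (intro integrableI_nonneg) auto
  show "expectation (\<lambda>\<omega>. real (N \<omega>)) = (\<Sum>j. prob {\<omega> \<in> space M. j < N \<omega>})"
    using meas nn summ by (subst integral_eq_nn_integral) (auto simp: suminf_nonneg)
qed

lemma (in faulty_transmissions) measurable_S:
  "\<lbrakk>1 \<le> k; l \<in> L\<rbrakk> \<Longrightarrow> S k l \<in> measurable M (count_space UNIV)"
  using indep_S unfolding indep_vars_def by force

lemma (in faulty_transmissions) prob_S_le:
  assumes kl: "1 \<le> k" "l \<in> L"
  shows "prob (S k l -` {..j} \<inter> space M) = 1 - p ^ j"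
proof -
  have [measurable]: "S k l \<in> measurable M (count_space UNIV)"
    using kl by (rule measurable_S)
  have "S k l -` {..j} \<inter> space M = (\<Union>i\<in>{1..j}. {\<omega> \<in> space M. S k l \<omega> = i})"
    using S_pos[OF kl] by auto
  also have "prob \<dots> = (\<Sum>i\<in>{1..j}. prob {\<omega> \<in> space M. S k l \<omega> = i})"
    by (rule finite_measure_finite_Union) (auto simp: disjoint_family_on_def)
  also have "\<dots> = (\<Sum>i\<in>{1..j}. p ^ (i - 1) * (1 - p))"
    using kl by (intro sum.cong) (auto simp: prob_S)
  also have "\<dots> = 1 - p ^ j"
    by (induction j) (auto simp: algebra_simps)
  finally show ?thesis .
qed

text \<open>
  Independence of the links turns the probability that all of them succeed within \<open>j\<close> rounds into
  the \<open>card L\<close>-th power of the probability for one link.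
\<close>

lemma (in faulty_transmissions) prob_rounds_gt:
  assumes k: "1 \<le> k" and L: "finite L" "L \<noteq> {}"
  shows "rounds L S k \<in> measurable M (count_space UNIV)"
    and "prob {\<omega> \<in> space M. j < rounds L S k \<omega>} = 1 - (1 - p ^ j) ^ card L"
proof -
  have "rounds L S k \<omega> \<le> j \<longleftrightarrow> (\<forall>l\<in>L. S k l \<omega> \<le> j)" for j \<omega>
    using L by (simp add: rounds_def)
  then have le: "rounds L S k -` {..j} \<inter> space M = (\<Inter>l\<in>L. S k l -` {..j} \<inter> space M)" for j
    using L by auto
  have [measurable]: "S k l \<in> measurable M (count_space UNIV)" if "l \<in> L" for l
    using k that by (rule measurable_S)
  \<comment> \<open>The event of at most \<open>i\<close> rounds is an intersection over the links; differences of such events give single values.\<close>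
  show meas [measurable]: "rounds L S k \<in> measurable M (count_space UNIV)"
  proof (rule measurable_count_space_eq2_countable[THEN iffD2], intro conjI ballI)
    fix i :: nat
    have sets: "rounds L S k -` {..i} \<inter> space M \<in> sets M" for i
      unfolding le using L by (intro sets.finite_INT) (auto intro: measurable_sets)
    have "rounds L S k -` {i} \<inter> space M =
        (rounds L S k -` {..i} \<inter> space M) - (\<Union>i'<i. rounds L S k -` {..i'} \<inter> space M)"
      by force
    also have "\<dots> \<in> sets M"
      using sets by (intro sets.Diff sets.finite_UN) auto
    finally show "rounds L S k -` {i} \<inter> space M \<in> sets M" .
  qed auto
  have "indep_vars (\<lambda>_. count_space UNIV) (\<lambda>(k, l). S k l) ({k} \<times> L)"
    using indep_S by (rule indep_vars_subset) (use k in auto)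
  from indep_varsD_finite[OF this, of "\<lambda>_. {..j}"] L
  have "prob (\<Inter>kl\<in>{k} \<times> L. (case kl of (k, l) \<Rightarrow> S k l) -` {..j} \<inter> space M)
      = (\<Prod>kl\<in>{k} \<times> L. prob ((case kl of (k, l) \<Rightarrow> S k l) -` {..j} \<inter> space M))"
    by simp
  moreover have "(\<Inter>kl\<in>{k} \<times> L. (case kl of (k, l) \<Rightarrow> S k l) -` {..j} \<inter> space M)
      = (\<Inter>l\<in>L. S k l -` {..j} \<inter> space M)"
    by auto
  moreover have "(\<Prod>kl\<in>{k} \<times> L. prob ((case kl of (k, l) \<Rightarrow> S k l) -` {..j} \<inter> space M))
      = (\<Prod>l\<in>L. prob (S k l -` {..j} \<inter> space M))"
    by (rule prod.reindex_bij_witness[of _ "Pair k" snd]) auto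
  ultimately have "prob (\<Inter>l\<in>L. S k l -` {..j} \<inter> space M)
      = (\<Prod>l\<in>L. prob (S k l -` {..j} \<inter> space M))"
    by (simp only:)
  also have "\<dots> = (1 - p ^ j) ^ card L"
    using k by (simp add: prob_S_le)
  finally have "prob (rounds L S k -` {..j} \<inter> space M) = (1 - p ^ j) ^ card L"
    by (simp add: le)
  moreover have "{\<omega> \<in> space M. j < rounds L S k \<omega>} = space M - (rounds L S k -` {..j} \<inter> space M)"
    by auto
  ultimately show "prob {\<omega> \<in> space M. j < rounds L S k \<omega>} = 1 - (1 - p ^ j) ^ card L"
    by (subst \<open>_ = space M - _\<close>, subst prob_compl) (auto intro: measurable_sets)
qed

lemma (in faulty_transmissions) expectation_rounds:
  assumes p: "0 < p" "p < 1" and k: "1 \<le> k" and L: "finite L" "L \<noteq> {}"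
  shows "integrable M (\<lambda>\<omega>. real (rounds L S k \<omega>))"
    and "ln (card L) / ln (1 / p) \<le> expectation (\<lambda>\<omega>. real (rounds L S k \<omega>))"
    and "expectation (\<lambda>\<omega>. real (rounds L S k \<omega>)) \<le> (1 + ln (card L)) / ln (1 / p) + 1"
proof -
  note gt = prob_rounds_gt[OF k L]
  note tail = max_geometric_tail_sum[OF p, of "card L"]
  note E = expectation_nat_eq_tail_sum[OF gt(1), unfolded gt(2), OF tail(1)]
  show "integrable M (\<lambda>\<omega>. real (rounds L S k \<omega>))"
    by (rule E(1))
  have l: "0 < ln (1 / p)"
    using p by simp
  have n: "0 < card L"
    using L by (simp add: card_gt_0_iff)
  have "ln (card L) \<le> ln (real (card L) + 1)"
    using n by simp
  then have "ln (card L) \<le> (harm (card L) :: real)"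
    using ln_le_harm[of "card L"] by linarith
  then have "ln (card L) / ln (1 / p) \<le> harm (card L) / ln (1 / p)"
    using l by (intro divide_right_mono) auto
  then show "ln (card L) / ln (1 / p) \<le> expectation (\<lambda>\<omega>. real (rounds L S k \<omega>))"
    using tail(2) unfolding E(2) by linarith
  have "harm (card L) \<le> 1 + ln (real (card L))"
    using euler_mascheroni_sequence_decreasing[of 1 "card L"] n by (simp add: harm_expand)
  then have "harm (card L) / ln (1 / p) \<le> (1 + ln (card L)) / ln (1 / p)"
    using l by (intro divide_right_mono) auto
  then show "expectation (\<lambda>\<omega>. real (rounds L S k \<omega>)) \<le> (1 + ln (card L)) / ln (1 / p) + 1"
    using tail(3) unfolding E(2) by linarith
qed

lemma (in faulty_transmissions) expectation_elapsed:
  assumes p: "0 < p" "p < 1" and L: "finite L" "L \<noteq> {}" and "0 \<le> \<tau>"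
  shows "integrable M (\<lambda>\<omega>. elapsed \<tau> (\<lambda>k. rounds L S k \<omega>) n)"
    and "real n * \<tau> * (ln (card L) / ln (1 / p))
      \<le> expectation (\<lambda>\<omega>. elapsed \<tau> (\<lambda>k. rounds L S k \<omega>) n)"
    and "expectation (\<lambda>\<omega>. elapsed \<tau> (\<lambda>k. rounds L S k \<omega>) n)
      \<le> real n * \<tau> * ((1 + ln (card L)) / ln (1 / p) + 1)"
proof -
  note rounds = expectation_rounds[OF p _ L]
  show "integrable M (\<lambda>\<omega>. elapsed \<tau> (\<lambda>k. rounds L S k \<omega>) n)"
    unfolding elapsed_def using rounds(1) by (intro integrable_mult_right Bochner_Integration.integrable_sum) auto
  have E: "expectation (\<lambda>\<omega>. elapsed \<tau> (\<lambda>k. rounds L S k \<omega>) n)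
      = \<tau> * (\<Sum>k=1..n. expectation (\<lambda>\<omega>. real (rounds L S k \<omega>)))"
    unfolding elapsed_def using rounds(1) by (simp add: Bochner_Integration.integral_sum)
  have "real (card {1..n}) * (ln (card L) / ln (1 / p))
      \<le> (\<Sum>k=1..n. expectation (\<lambda>\<omega>. real (rounds L S k \<omega>)))"
    by (rule sum_bounded_below) (use rounds(2) in auto)
  then have "\<tau> * (real n * (ln (card L) / ln (1 / p)))
      \<le> \<tau> * (\<Sum>k=1..n. expectation (\<lambda>\<omega>. real (rounds L S k \<omega>)))"
    using \<open>0 \<le> \<tau>\<close> by (intro mult_left_mono) auto
  then show "real n * \<tau> * (ln (card L) / ln (1 / p))
      \<le> expectation (\<lambda>\<omega>. elapsed \<tau> (\<lambda>k. rounds L S k \<omega>) n)"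
    unfolding E by (simp only: mult_ac)
  have "(\<Sum>k=1..n. expectation (\<lambda>\<omega>. real (rounds L S k \<omega>)))
      \<le> real (card {1..n}) * ((1 + ln (card L)) / ln (1 / p) + 1)"
    by (rule sum_bounded_above) (use rounds(3) in auto)
  then have "\<tau> * (\<Sum>k=1..n. expectation (\<lambda>\<omega>. real (rounds L S k \<omega>)))
      \<le> \<tau> * (real n * ((1 + ln (card L)) / ln (1 / p) + 1))"
    using \<open>0 \<le> \<tau>\<close> by (intro mult_left_mono) auto
  then show "expectation (\<lambda>\<omega>. elapsed \<tau> (\<lambda>k. rounds L S k \<omega>) n)
      \<le> real n * \<tau> * ((1 + ln (card L)) / ln (1 / p) + 1)"
    unfolding E by (simp only: mult_ac)
qed

lemma (in faulty_transmissions) rounds_pos: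
  assumes "finite L" "L \<noteq> {}" "1 \<le> k" "\<omega> \<in> space M"
  shows "1 \<le> rounds L S k \<omega>"
proof -
  obtain l where l: "l \<in> L"
    using \<open>L \<noteq> {}\<close> by blast
  have "1 \<le> S k l \<omega>"
    using assms l by (intro S_pos)
  also have "\<dots> \<le> rounds L S k \<omega>"
    unfolding rounds_def using \<open>finite L\<close> l by (intro Max_ge) auto
  finally show ?thesis .
qed

section \<open>Time to reach a given accuracy\<close>

theorem theorem3:
  fixes X :: "'a::euclidean_space set" and nrm :: "'a \<Rightarrow> real"
    and A :: "(real^'d::finite)^'n::finite \<Rightarrow> 'a \<Rightarrow> 'a" and C :: "'n \<Rightarrow> 'a \<Rightarrow> real^'d"
    and \<sigma> L\<^sub>A L\<^sub>C D \<theta> p \<epsilon> :: real and xs x0 :: 'a and b :: nat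
    and R :: "real \<Rightarrow> real \<Rightarrow> real"
    and M :: "'w measure" and L :: "('v \<times> 'v) set" and S :: "nat \<Rightarrow> 'v \<times> 'v \<Rightarrow> 'w \<Rightarrow> nat"
    and \<alpha> \<tau> :: real and x :: "nat \<Rightarrow> 'a" and m :: "'w \<Rightarrow> nat \<Rightarrow> nat" and k\<^sub>\<epsilon> :: nat and T :: "'w \<Rightarrow> real"
  assumes \<alpha>_def: "\<alpha> = rate \<sigma> L\<^sub>A L\<^sub>C b"
    and x_def: "x = quantized_iterate A C (radius \<sigma> L\<^sub>A L\<^sub>C b D) b x0"
    and \<tau>_def: "\<tau> = delay R (real (b * CARD('d)) + \<theta>) p"
    and m_def: "m = (\<lambda>\<omega> k. rounds L S k \<omega>)"
    and k\<^sub>\<epsilon>_def: "k\<^sub>\<epsilon> = num_iterations \<alpha> D \<epsilon>"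
    and T_def: "T = (\<lambda>\<omega>. elapsed \<tau> (m \<omega>) k\<^sub>\<epsilon>)"
    and "norm_on (span X) nrm"
    and "\<And>c x. x \<in> X \<Longrightarrow> A c x \<in> X"
    and "0 < \<sigma>" "\<sigma> < 1" "0 < L\<^sub>A" "0 \<le> L\<^sub>C"
    and "linear_convergent X nrm A C \<sigma> xs L\<^sub>A L\<^sub>C"
    and "1 \<le> b" and "x0 \<in> X" and "0 < D"
    and "nrm (x 1 - x 0) \<le> (1 - \<sigma>) * D \<or> nrm (x0 - xs) \<le> D"
    and "\<alpha> < 1"
    and "0 < p" "p < 1" "finite L" "L \<noteq> {}" "0 \<le> \<theta>"
    and "\<And>n q. \<lbrakk>0 < n; 0 < q; q < 1\<rbrakk> \<Longrightarrow> 0 < R n q"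
    and "faulty_transmissions M L p S"
    and "0 < \<epsilon>"
  shows "(\<forall>\<omega>\<in>space M. \<forall>t\<ge>T \<omega>. nrm (in_time \<tau> (m \<omega>) x t - xs) \<le> \<epsilon>) \<and>
         integrable M T \<and>
         real k\<^sub>\<epsilon> * \<tau> * (ln (card L) / ln (1 / p)) \<le> prob_space.expectation M T \<and>
         prob_space.expectation M T \<le> real k\<^sub>\<epsilon> * \<tau> * ((1 + ln (card L)) / ln (1 / p) + 1)"
proof -
  interpret faulty_transmissions M L p S by fact
  have "0 < real (b * CARD('d)) + \<theta>"
    using \<open>1 \<le> b\<close> \<open>0 \<le> \<theta>\<close> by (intro add_pos_nonneg) (auto simp: card_gt_0_iff)
  then have "0 < \<tau>"
    using \<open>\<And>n q. \<lbrakk>0 < n; 0 < q; q < 1\<rbrakk> \<Longrightarrow> 0 < R n q\<close> \<open>0 < p\<close> \<open>p < 1\<close>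
    by (simp add: \<tau>_def delay_def)
  have contract: "nrm (A (stack C y) y - xs) \<le> \<sigma> * nrm (y - xs)" if "y \<in> X" for y
    using \<open>linear_convergent X nrm A C \<sigma> xs L\<^sub>A L\<^sub>C\<close> that unfolding linear_convergent_def by blast
  have "xs \<in> X"
    using \<open>linear_convergent X nrm A C \<sigma> xs L\<^sub>A L\<^sub>C\<close> unfolding linear_convergent_def by blast
  have x_0: "x 0 = x0" and x_1: "x 1 = A (stack C x0) x0"
    by (simp_all add: x_def quantized_iterate_def Let_def)
  have start: "nrm (x0 - xs) \<le> D"
    using \<open>nrm (x 1 - x 0) \<le> (1 - \<sigma>) * D \<or> nrm (x0 - xs) \<le> D\<close>
  proof
    assume "nrm (x 1 - x 0) \<le> (1 - \<sigma>) * D"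
    then show ?thesis
      unfolding x_0 x_1
      using contract \<open>norm_on (span X) nrm\<close> \<open>x0 \<in> X\<close> \<open>xs \<in> X\<close> \<open>\<sigma> < 1\<close>
        \<open>\<And>c x. x \<in> X \<Longrightarrow> A c x \<in> X\<close>
      by (intro short_contracting_step_imp_close[of X nrm x0 "A (stack C x0) x0" xs \<sigma> D]) auto
  qed
  have error: "nrm (x k - xs) \<le> \<alpha> ^ k * D" for k
    unfolding x_def
    by (rule quantized_iterates_converge[where A = A and X = X]) (use assms start in simp_all)
  have "0 \<le> gain \<sigma> L\<^sub>A L\<^sub>C / (2 ^ b - 1)"
    by (simp add: gain_def)
  then have "0 < \<alpha>"
    using \<open>0 < \<sigma>\<close> by (simp add: \<alpha>_def rate_def)
  have accurate: "nrm (in_time \<tau> (m \<omega>) x t - xs) \<le> \<epsilon>" if \<omega>: "\<omega> \<in> space M" and t: "T \<omega> \<le> t" for \<omega> t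
  proof -
    have "\<exists>k\<ge>k\<^sub>\<epsilon>. in_time \<tau> (m \<omega>) x t = x k"
      using \<open>0 < \<tau>\<close> t rounds_pos[OF \<open>finite L\<close> \<open>L \<noteq> {}\<close> _ \<omega>]
      by (intro in_time_eq_late_iterate) (auto simp: m_def T_def)
    then obtain k where k: "k\<^sub>\<epsilon> \<le> k" "in_time \<tau> (m \<omega>) x t = x k"
      by blast
    have "\<alpha> ^ k * D \<le> \<epsilon>"
      using \<open>0 < \<alpha>\<close> \<open>\<alpha> < 1\<close> \<open>0 < D\<close> \<open>0 < \<epsilon>\<close> k(1) unfolding k\<^sub>\<epsilon>_def by (rule power_num_iterations_le)
    then show ?thesis
      using error[of k] k(2) by simp
  qed
  note T = expectation_elapsed[OF \<open>0 < p\<close> \<open>p < 1\<close> \<open>finite L\<close> \<open>L \<noteq> {}\<close> less_imp_le[OF \<open>0 < \<tau>\<close>],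
      of k\<^sub>\<epsilon>, folded T_def[unfolded m_def]]
  show ?thesis
    by (intro conjI ballI allI impI accurate T)
qed

end
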